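(* For every integer $n\ge 1$, let $O_n$ be the number of acyclic digraphs on $n$ labelled vertices all of whose vertices have even out-degree, and for every integer $k\ge 0$ let $R_k$ be the number of acyclic digraphs on $k$ labelled vertices. Then $$O_n=\sum_{k=1}^{n}(-1)^{k+1}\binom{n}{k}2^{(k-1)(n-k)}R_{n-k}.$$
   Context: A (simple) digraph with $n$ labelled vertices is a pair $(V,E)$ with $V=\{v_1,\dots,v_n\}$ and $E\subseteq\{(u,v)\in V\times V: u\neq v\}$ (no loops, at most one edge from $u$ to $v$). It is acyclic if it contains no directed cycle, i.e. no closed directed walk $v_0,v_1,\dots,v_k=v_0$ with $k\ge 1$, $(v_i,v_{i+1})\in E$ for all $0\le i\le k-1$, and all the $v_i$ distinct except $v_0=v_k$. The out-degree of a vertex $v$ is the number of edges with initial vertex $v$. By convention $R_0=1$ (the empty digraph). (In the source, $O_n$ is also the number of orientable small covers over the $n$-cube, and $R_n$ the number of all small covers over the $n$-cube, up to Davis–Januszkiewicz equivalence; the claim is about the digraph counts just defined.) *)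

theory Defs
  imports Complex_Main "Graph_Theory.Graph_Theory"
begin

text \<open>
  The locale predicate \<^const>\<open>pair_digraph\<close> says that the arcs join vertices, that there are no
  loops, and that both vertex and arc set are finite; arcs are ordered pairs, so there are no
  parallel arcs. Digraphs are counted as labelled objects, not up to isomorphism.
\<close>
definition labelled_digraphs :: "nat \<Rightarrow> nat pair_pre_digraph set" where
  "labelled_digraphs n = {G. pair_digraph G \<and> pverts G = {1..n}}"

text \<open>
  \<^const>\<open>pre_digraph.cycle\<close> is a nonempty closed directed walk whose vertices are distinct except
  that the first equals the last. In particular an antiparallel pair of arcs is a cycle.
\<close>
definition acyclic_digraph :: "'a pair_pre_digraph \<Rightarrow> bool" where
  "acyclic_digraph G \<longleftrightarrow> \<not> (\<exists>p. pre_digraph.cycle (with_proj G) p)"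

definition num_acyclic :: "nat \<Rightarrow> nat" where
  "num_acyclic n = card {G \<in> labelled_digraphs n. acyclic_digraph G}"

definition num_acyclic_even_out :: "nat \<Rightarrow> nat" where
  "num_acyclic_even_out n =
    card {G \<in> labelled_digraphs n.
            acyclic_digraph G \<and> (\<forall>v \<in> pverts G. even (out_degree (with_proj G) v))}"

text \<open>The convention for the empty digraph needs no separate clause.\<close>
lemma num_acyclic_0: "num_acyclic 0 = 1"
proof -
  have "{G \<in> labelled_digraphs 0. acyclic_digraph G} = {\<lparr>pverts = {}, parcs = {}\<rparr>}" (is "?L = {?E}")
  proof (intro equalityI subsetI)
    fix G assume "G \<in> ?L"
    then have "pair_digraph G" and V: "pverts G = {}"
      by (auto simp: labelled_digraphs_def)
    then interpret pair_digraph G by simp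
    have "parcs G = {}" using V arc_fst_in_verts by auto
    with V show "G \<in> {?E}" by simp
  next
    fix G assume "G \<in> {?E}"
    moreover have "pair_digraph ?E" by unfold_locales auto
    moreover have "acyclic_digraph ?E"
      by (auto simp: acyclic_digraph_def pre_digraph.cycle_def pre_digraph.awalk_def)
    ultimately show "G \<in> ?L" by (simp add: labelled_digraphs_def)
  qed
  then show ?thesis by (simp add: num_acyclic_def)
qed

end

theory Submission
  imports Defs
begin

text \<open>
  The identity is an inclusion--exclusion over sets of sinks. In a finite acyclic digraph on a
  nonempty vertex set some vertex is a sink, so the digraphs counted by \<open>O\<^sub>n\<close> are the union over
  \<open>v\<close> of those in which \<open>v\<close> is a sink, and
  \<open>O\<^sub>n = (\<Sum>S \<noteq> {}. (- 1)^(|S| + 1) * N(S))\<close>, where \<open>N(S)\<close> counts those in which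
  all of \<open>S\<close> are sinks (\<open>even_acyclic_eq_sum_over_sinks\<close>).

  To compute \<open>N(S)\<close> for \<open>|S| = k\<close>, split the arc set into the arcs among the \<open>n - k\<close> other vertices
  and the arcs from these into \<open>S\<close>. Vertices of \<open>S\<close> have out-degree \<open>0\<close>, which is even. The first part
  is an arbitrary acyclic digraph: arcs into sinks never close a cycle, and whatever parity a vertex
  outside \<open>S\<close> has within the first part is corrected by its arcs into \<open>S\<close>. These form a subset of
  \<open>S\<close> of prescribed parity, and as \<open>S\<close> is nonempty there are \<open>2^(k-1)\<close> of them. Hence
  \<open>N(S) = R\<^bsub>n-k\<^esub> \<cdot> (2^(k-1))^(n-k)\<close> (\<open>card_even_acyclic_with_sinks\<close>), and collecting the
  \<open>n choose k\<close> sets \<open>S\<close> of each size gives the formula.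
\<close>

section \<open>Acyclic relations on a vertex set\<close>

definition acyclic_rels :: "'a set \<Rightarrow> 'a rel set" where
  "acyclic_rels V = {E. E \<subseteq> V \<times> V \<and> acyclic E}"

definition even_acyclic_rels :: "'a set \<Rightarrow> 'a rel set" where
  "even_acyclic_rels V = {E \<in> acyclic_rels V. \<forall>v\<in>V. even (card (E `` {v}))}"

lemma finite_acyclic_rels: "finite V \<Longrightarrow> finite (acyclic_rels V)"
  by (rule finite_subset[of _ "Pow (V \<times> V)"]) (auto simp: acyclic_rels_def)

lemma finite_even_acyclic_rels: "finite V \<Longrightarrow> finite (even_acyclic_rels V)"
  by (simp add: even_acyclic_rels_def finite_acyclic_rels)

lemma finite_acyclic_rel_has_sink:
  assumes "finite V" "V \<noteq> {}" "E \<in> acyclic_rels V"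
  obtains v where "v \<in> V" "E `` {v} = {}"
proof -
  have "finite E"
    using assms(1,3) by (intro finite_subset[of E "V \<times> V"]) (auto simp: acyclic_rels_def)
  then have "wf (E\<inverse>)"
    using assms(3) by (auto simp: acyclic_rels_def intro: finite_acyclic_wf_converse)
  with assms(2) obtain v where "v \<in> V" "\<And>y. (y, v) \<in> E\<inverse> \<Longrightarrow> y \<notin> V"
    by (metis ex_in_conv wfE_min)
  with that assms(3) show thesis by (auto simp: acyclic_rels_def)
qed

text \<open>
  A walk that enters \<open>Range G\<close> is stuck there, so every walk uses arcs of \<open>F\<close> only, except possibly
  for its last arc; and a walk that ends in \<open>Range G\<close> does not return to its start.
\<close>
lemma acyclic_Un_into_sinks:
  assumes "acyclic F" and sinks: "Range G \<inter> Domain (F \<union> G) = {}"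
  shows "acyclic (F \<union> G)"
proof -
  have walk: "(x, y) \<in> F\<^sup>+ \<or> y \<in> Range G" if "(x, y) \<in> (F \<union> G)\<^sup>+" for x y
    using that
  proof (induction rule: trancl_induct)
    case (step y z)
    then show ?case using sinks by (auto intro: trancl_into_trancl)
  qed auto
  show ?thesis
  proof (rule acyclicI, intro allI notI)
    fix x assume x: "(x, x) \<in> (F \<union> G)\<^sup>+"
    then have "x \<in> Domain (F \<union> G)" by (metis DomainI trancl_domain)
    with walk[OF x] assms show False by (auto simp: acyclic_def)
  qed
qed

lemma acyclic_inv_image:
  assumes "acyclic E"
  shows "acyclic (inv_image E f)"
proof (rule acyclicI, intro allI notI)
  fix x assume "(x, x) \<in> (inv_image E f)\<^sup>+"
  moreover have "(f x, f y) \<in> E\<^sup>+" if "(x, y) \<in> (inv_image E f)\<^sup>+" for x y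
    using that by (induction rule: trancl_induct) (auto intro: trancl_into_trancl)
  ultimately show False using assms by (auto simp: acyclic_def)
qed

text \<open>
  The vertices that remain after removing a set of sinks need not be an initial segment of the numbers.
  Relabelling along an injection shows that only their number matters.
\<close>
lemma card_acyclic_rels_le:
  assumes "finite W" "card V \<le> card W" "finite V"
  shows "card (acyclic_rels V) \<le> card (acyclic_rels W)"
proof -
  obtain f where f: "f ` V \<subseteq> W" "inj_on f V"
    using assms by (meson card_le_inj)
  show ?thesis
  proof (rule card_inj_on_le)
    show "inj_on (\<lambda>E. map_prod f f ` E) (acyclic_rels V)"
    proof (rule inj_on_subset)
      show "inj_on (\<lambda>E. map_prod f f ` E) (Pow (V \<times> V))"
        using f(2) by (intro inj_on_image_Pow map_prod_inj_on)
    qed (auto simp: acyclic_rels_def)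
    show "(\<lambda>E. map_prod f f ` E) ` acyclic_rels V \<subseteq> acyclic_rels W"
    proof
      fix E' assume "E' \<in> (\<lambda>E. map_prod f f ` E) ` acyclic_rels V"
      then obtain E where E: "E \<subseteq> V \<times> V" "acyclic E" and E': "E' = map_prod f f ` E"
        by (auto simp: acyclic_rels_def)
      \<comment> \<open>Undoing the relabelling turns a cycle of \<open>E'\<close> into one of \<open>E\<close>.\<close>
      have "E' \<subseteq> inv_image E (inv_into V f)"
        using E f by (auto simp: E' in_inv_image)
      then have "acyclic E'" using E(2) by (meson acyclic_inv_image acyclic_subset)
      with E(1) f(1) show "E' \<in> acyclic_rels W" by (auto simp: acyclic_rels_def E')
    qed
  qed (simp add: assms finite_acyclic_rels)
qed

lemma card_acyclic_rels_eq:
  assumes "finite V" "finite W" "card V = card W"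
  shows "card (acyclic_rels V) = card (acyclic_rels W)"
  using assms by (intro antisym card_acyclic_rels_le) auto

section \<open>Subsets of prescribed parity\<close>

text \<open>Toggling membership of one fixed element exchanges the even and the odd subsets.\<close>
lemma card_subsets_with_parity:
  assumes "finite S" "S \<noteq> {}"
  shows "card {A. A \<subseteq> S \<and> even (card A) = b} = 2 ^ (card S - 1)"
proof -
  obtain a where a: "a \<in> S" using assms by blast
  define toggle where "toggle A = (if a \<in> A then A - {a} else insert a A)" for A
  define C where "C b = {A. A \<subseteq> S \<and> even (card A) = b}" for b
  have fin: "finite (C b)" for b using assms by (simp add: C_def)
  have toggle: "toggle A \<in> C (\<not> b)" "toggle (toggle A) = A" if "A \<in> C b" for A b
  proof -
    have "finite A" using that finite_subset[OF _ assms(1)] by (simp add: C_def)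
    then show "toggle A \<in> C (\<not> b)"
      using that a by (cases "a \<in> A") (auto simp: C_def toggle_def card_Diff_singleton card_gt_0_iff)
    show "toggle (toggle A) = A" by (auto simp: toggle_def)
  qed
  have "bij_betw toggle (C b) (C (\<not> b))"
    using toggle[of _ b] toggle[of _ "\<not> b"] by (intro bij_betw_byWitness[where f' = toggle]) auto
  then have "card (C b) = card (C (\<not> b))" by (rule bij_betw_same_card)
  moreover have "card (C b) + card (C (\<not> b)) = card (C b \<union> C (\<not> b))"
    using fin by (intro card_Un_disjoint[symmetric]) (auto simp: C_def)
  moreover have "C b \<union> C (\<not> b) = Pow S" by (auto simp: C_def)
  ultimately have "2 * card (C b) = 2 ^ card S"
    using assms by (simp add: card_Pow)
  also have "\<dots> = 2 * 2 ^ (card S - 1)"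
    using assms by (simp add: card_gt_0_iff flip: power_Suc)
  finally show ?thesis by (simp add: C_def)
qed

section \<open>Counting with a prescribed set of sinks\<close>

text \<open>
  The bijection sends \<open>E\<close> to its restriction to \<open>V - S\<close>, together with the function that maps each
  vertex of \<open>V - S\<close> to its set of out-neighbours in \<open>S\<close>. The parity condition on \<open>E\<close> at such a
  vertex says exactly that this set has the parity of the out-degree within the restriction; at the
  sinks it holds trivially.
\<close>
lemma card_even_acyclic_with_sinks:
  fixes V :: "'a set"
  assumes "finite V" "S \<subseteq> V" "S \<noteq> {}"
  shows "card {E \<in> even_acyclic_rels V. E `` S = {}}
    = card (acyclic_rels (V - S)) * 2 ^ ((card S - 1) * card (V - S))"
proof -
  let ?W = "V - S"
  define T where "T F v = {A. A \<subseteq> S \<and> even (card A) = even (card (F `` {v}))}" for F :: "'a rel" and v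
  define join where "join = (\<lambda>(F :: 'a rel, g). F \<union> Sigma ?W g)"
  define split where "split E = (E \<inter> ?W \<times> ?W, \<lambda>v\<in>?W. E `` {v} \<inter> S)" for E
  let ?D = "SIGMA F : acyclic_rels ?W. Pi\<^sub>E ?W (T F)"
  let ?R = "{E \<in> even_acyclic_rels V. E `` S = {}}"
  have finS: "finite S" using assms finite_subset by blast
  have "bij_betw join ?D ?R"
  proof (rule bij_betw_byWitness[where f' = split])
    show "\<forall>p\<in>?D. split (join p) = p"
    proof clarify
      fix F g assume F: "F \<in> acyclic_rels ?W" and g: "g \<in> Pi\<^sub>E ?W (T F)"
      have sub: "g v \<subseteq> S" if "v \<in> ?W" for v using g that by (auto simp: T_def PiE_iff)
      have "(F \<union> Sigma ?W g) \<inter> ?W \<times> ?W = F"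
        using F sub by (auto simp: acyclic_rels_def)
      moreover have "(\<lambda>v\<in>?W. (F \<union> Sigma ?W g) `` {v} \<inter> S) = g"
      proof
        fix v show "(\<lambda>v\<in>?W. (F \<union> Sigma ?W g) `` {v} \<inter> S) v = g v"
        proof (cases "v \<in> ?W")
          case True
          then show ?thesis using F sub[OF True] by (auto simp: acyclic_rels_def)
        next
          case False
          then show ?thesis by (simp only: PiE_arb[OF g False] restrict_apply if_False)
        qed
      qed
      ultimately show "split (join (F, g)) = (F, g)" by (simp add: split_def join_def)
    qed
    show "\<forall>E\<in>?R. join (split E) = E"
    proof
      fix E assume E: "E \<in> ?R"
      then have "E \<subseteq> ?W \<times> V" by (auto simp: even_acyclic_rels_def acyclic_rels_def)
      then show "join (split E) = E" by (auto simp: join_def split_def split: if_splits)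
    qed
    show "join ` ?D \<subseteq> ?R"
    proof (rule image_subsetI)
      fix p assume "p \<in> ?D"
      then obtain F g where p: "p = (F, g)"
        and F: "F \<in> acyclic_rels ?W" and g: "g \<in> Pi\<^sub>E ?W (T F)" by blast
      have sub: "g v \<subseteq> S" and par: "even (card (g v)) = even (card (F `` {v}))" if "v \<in> ?W" for v
        using g that by (auto simp: T_def PiE_iff)
      let ?E = "F \<union> Sigma ?W g"
      have FW: "F \<subseteq> ?W \<times> ?W" "acyclic F" using F by (auto simp: acyclic_rels_def)
      have "Range (Sigma ?W g) \<subseteq> S" using sub by blast
      then have "acyclic ?E" using FW by (intro acyclic_Un_into_sinks) auto
      moreover have "?E \<subseteq> V \<times> V" using FW sub assms(2) by blast
      moreover have "?E `` S = {}" using FW by blast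
      moreover have "even (card (?E `` {v}))" if "v \<in> V" for v
      proof (cases "v \<in> S")
        case True
        then have "?E `` {v} = {}" using FW by blast
        then show ?thesis by simp
      next
        case False
        then have v: "v \<in> ?W" using that by simp
        have "card (?E `` {v}) = card (F `` {v} \<union> g v)"
          using v by (intro arg_cong[where f = card]) auto
        also have "\<dots> = card (F `` {v}) + card (g v)"
        proof (rule card_Un_disjoint)
          show "finite (F `` {v})"
            using assms(1) by (rule finite_subset[rotated]) (use FW in blast)
          show "finite (g v)" using finS sub[OF v] by (rule finite_subset[rotated])
          show "F `` {v} \<inter> g v = {}" using FW sub[OF v] by blast
        qed
        finally show ?thesis using par[OF v] by simp
      qed
      ultimately show "join p \<in> ?R"
        by (simp add: p join_def even_acyclic_rels_def acyclic_rels_def)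
    qed
    show "split ` ?R \<subseteq> ?D"
    proof (rule image_subsetI)
      fix E assume "E \<in> ?R"
      then have EV: "E \<subseteq> V \<times> V" "acyclic E" and ev: "\<And>v. v \<in> V \<Longrightarrow> even (card (E `` {v}))"
        by (auto simp: even_acyclic_rels_def acyclic_rels_def)
      have "E \<inter> ?W \<times> ?W \<in> acyclic_rels ?W"
        using acyclic_subset[OF EV(2), of "E \<inter> ?W \<times> ?W"] by (simp add: acyclic_rels_def)
      moreover have "E `` {v} \<inter> S \<in> T (E \<inter> ?W \<times> ?W) v" if v: "v \<in> ?W" for v
      proof -
        have fin: "finite ((E \<inter> ?W \<times> ?W) `` {v})"
          using assms(1) by (rule finite_subset[rotated]) auto
        have "card (E `` {v}) = card ((E `` {v} \<inter> S) \<union> (E \<inter> ?W \<times> ?W) `` {v})"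
          using EV v by (intro arg_cong[where f = card]) blast
        also have "\<dots> = card (E `` {v} \<inter> S) + card ((E \<inter> ?W \<times> ?W) `` {v})"
          using finS fin by (intro card_Un_disjoint) auto
        finally have "card (E `` {v}) = \<dots>" .
        then show ?thesis using ev[of v] v by (auto simp: T_def)
      qed
      ultimately show "split E \<in> ?D" by (auto simp: split_def)
    qed
  qed
  then have "card ?R = card ?D" by (simp add: bij_betw_same_card)
  also have "\<dots> = (\<Sum>F\<in>acyclic_rels ?W. \<Prod>v\<in>?W. card (T F v))"
    using assms(1) finS by (simp add: card_SigmaI card_PiE finite_acyclic_rels finite_PiE T_def)
  also have "\<dots> = (\<Sum>F\<in>acyclic_rels ?W. (2 ^ (card S - 1)) ^ card ?W)"
    using finS assms(3) by (simp add: T_def card_subsets_with_parity)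
  finally show ?thesis by (simp add: power_mult)
qed

text \<open>
  Inclusion--exclusion for the sets of relations having a given vertex as a sink; they cover
  everything because a sink always exists. Different vertices may give the same set (on two vertices
  only the empty relation qualifies), so the principle is used in its form for indexed families.
\<close>
lemma even_acyclic_eq_sum_over_sinks:
  assumes "finite V" "V \<noteq> {}"
  shows "int (card (even_acyclic_rels V)) =
    (\<Sum>S | S \<subseteq> V \<and> S \<noteq> {}.
      (- 1) ^ (card S + 1) * int (card {E \<in> even_acyclic_rels V. E `` S = {}}))"
proof -
  interpret Incl_Excl finite "int o card"
    by unfold_locales (auto simp: card_Un_disjnt)
  define X where "X v = {E \<in> even_acyclic_rels V. E `` {v} = {}}" for v
  have "(\<Union>v\<in>V. X v) = even_acyclic_rels V"
  proof
    show "even_acyclic_rels V \<subseteq> (\<Union>v\<in>V. X v)"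
    proof
      fix E assume E: "E \<in> even_acyclic_rels V"
      then have "E \<in> acyclic_rels V" by (simp add: even_acyclic_rels_def)
      from finite_acyclic_rel_has_sink[OF assms this] E show "E \<in> (\<Union>v\<in>V. X v)"
        unfolding X_def by blast
    qed
  qed (auto simp: X_def)
  moreover have "(\<Inter>v\<in>S. X v) = {E \<in> even_acyclic_rels V. E `` S = {}}" if "S \<noteq> {}" for S
    using that by (auto simp: X_def)
  moreover have "finite (X v)" for v
    using assms(1) by (simp add: X_def finite_even_acyclic_rels)
  ultimately show ?thesis
    using restricted_indexed[OF assms(1), of X] by simp
qed

lemma sum_nonempty_subsets_by_card:
  fixes g :: "nat \<Rightarrow> int"
  assumes "finite V"
  shows "(\<Sum>S | S \<subseteq> V \<and> S \<noteq> {}. g (card S)) = (\<Sum>k = 1..card V. int (card V choose k) * g k)"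
proof -
  let ?P = "{S. S \<subseteq> V \<and> S \<noteq> {}}"
  have "(\<Sum>S\<in>?P. g (card S)) = (\<Sum>k = 1..card V. \<Sum>S | S \<in> ?P \<and> card S = k. g (card S))"
  proof (rule sum.group[symmetric])
    show "card ` ?P \<subseteq> {1..card V}"
      using assms by (auto simp: card_mono Suc_le_eq card_gt_0_iff dest: finite_subset)
  qed (use assms in auto)
  also have "\<dots> = (\<Sum>k = 1..card V. int (card V choose k) * g k)"
  proof (rule sum.cong[OF refl])
    fix k assume k: "k \<in> {1..card V}"
    then have "{S. S \<in> ?P \<and> card S = k} = {S. S \<subseteq> V \<and> card S = k}" by auto
    then show "(\<Sum>S | S \<in> ?P \<and> card S = k. g (card S)) = int (card V choose k) * g k"
      using n_subsets[OF assms, of k] by simp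
  qed
  finally show ?thesis .
qed

section \<open>Digraphs and their arc relations\<close>

lemma acyclic_digraph_iff:
  assumes "pair_wf_digraph G"
  shows "acyclic_digraph G \<longleftrightarrow> acyclic (parcs G)"
proof -
  interpret pair_wf_digraph G by fact
  have "(\<exists>p. cycle p) \<longleftrightarrow> (\<exists>p. closed_w p)"
    using closed_w_imp_cycle cycle_altdef by blast
  also have "\<dots> \<longleftrightarrow> (\<exists>u. (u, u) \<in> (parcs G)\<^sup>+)"
    using reachable1_awalk by (auto simp: closed_w_def)
  finally show ?thesis by (simp add: acyclic_digraph_def acyclic_def)
qed

lemma out_degree_with_proj: "out_degree (with_proj G) v = card (parcs G `` {v})"
proof -
  have "out_arcs (with_proj G) v = Pair v ` (parcs G `` {v})" by auto
  then show ?thesis by (simp add: out_degree_def card_image inj_on_def)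
qed

text \<open>Looplessness of the digraph comes for free from acyclicity of the relation.\<close>
lemma acyclic_labelled_digraph_iff:
  "G \<in> labelled_digraphs n \<and> acyclic_digraph G
    \<longleftrightarrow> pverts G = {1..n} \<and> parcs G \<in> acyclic_rels {1..n}"
proof
  assume "G \<in> labelled_digraphs n \<and> acyclic_digraph G"
  then have "pair_digraph G" and V: "pverts G = {1..n}" and "acyclic_digraph G"
    by (auto simp: labelled_digraphs_def)
  then interpret pair_digraph G by simp
  have "acyclic (parcs G)"
    using acyclic_digraph_iff[OF pair_wf_digraph_axioms] \<open>acyclic_digraph G\<close> by simp
  moreover have "parcs G \<subseteq> {1..n} \<times> {1..n}"
    using in_arcsD1 in_arcsD2 V by auto
  ultimately show "pverts G = {1..n} \<and> parcs G \<in> acyclic_rels {1..n}"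
    using V by (simp add: acyclic_rels_def)
next
  assume "pverts G = {1..n} \<and> parcs G \<in> acyclic_rels {1..n}"
  then have V: "pverts G = {1..n}" and sub: "parcs G \<subseteq> {1..n} \<times> {1..n}" and ac: "acyclic (parcs G)"
    by (auto simp: acyclic_rels_def)
  have "finite (parcs G)" using sub finite_subset by blast
  then interpret pair_digraph G
    using V sub ac by unfold_locales (auto simp: acyclic_def dest: r_into_trancl)
  show "G \<in> labelled_digraphs n \<and> acyclic_digraph G"
    using V ac acyclic_digraph_iff[OF pair_wf_digraph_axioms] pair_digraph_axioms
    by (simp add: labelled_digraphs_def)
qed

lemma card_digraphs_by_arcs:
  fixes V :: "'a set"
  shows "card {G :: 'a pair_pre_digraph. pverts G = V \<and> P (parcs G)} = card {E. P E}"
proof (rule bij_betw_same_card)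
  show "bij_betw parcs {G :: 'a pair_pre_digraph. pverts G = V \<and> P (parcs G)} {E. P E}"
    by (rule bij_betw_byWitness[where f' = "\<lambda>E. \<lparr>pverts = V, parcs = E\<rparr>"]) auto
qed

lemma num_acyclic_eq: "num_acyclic n = card (acyclic_rels {1..n})"
  using card_digraphs_by_arcs[of "{1..n}" "\<lambda>E. E \<in> acyclic_rels {1..n}"]
  by (simp add: num_acyclic_def acyclic_labelled_digraph_iff)

lemma num_acyclic_even_out_eq: "num_acyclic_even_out n = card (even_acyclic_rels {1..n})"
proof -
  have "{G \<in> labelled_digraphs n.
            acyclic_digraph G \<and> (\<forall>v \<in> pverts G. even (out_degree (with_proj G) v))}
     = {G. pverts G = {1..n} \<and> parcs G \<in> even_acyclic_rels {1..n}}"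
    using acyclic_labelled_digraph_iff[of _ n]
    by (auto simp: even_acyclic_rels_def out_degree_with_proj)
  then show ?thesis
    using card_digraphs_by_arcs[of "{1..n}" "\<lambda>E. E \<in> even_acyclic_rels {1..n}"]
    by (simp add: num_acyclic_even_out_def)
qed

section \<open>The formula\<close>

theorem theorem3p1:
  fixes n :: nat
  assumes "n \<ge> 1"
  shows "int (num_acyclic_even_out n) =
    (\<Sum>k = 1..n. (-1) ^ (k + 1) * int (n choose k) * 2 ^ ((k - 1) * (n - k))
        * int (num_acyclic (n - k)))"
proof -
  let ?V = "{1..n}"
  let ?g = "\<lambda>k. (-1) ^ (k + 1) * (2 ^ ((k - 1) * (n - k)) * int (num_acyclic (n - k)))"
  have sink_count: "int (card {E \<in> even_acyclic_rels ?V. E `` S = {}})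
      = 2 ^ ((card S - 1) * (n - card S)) * int (num_acyclic (n - card S))"
    if "S \<subseteq> ?V" "S \<noteq> {}" for S
  proof -
    have "card (?V - S) = n - card S"
      using that(1) by (simp add: card_Diff_subset finite_subset)
    moreover from this have "card (acyclic_rels (?V - S)) = num_acyclic (n - card S)"
      unfolding num_acyclic_eq by (intro card_acyclic_rels_eq) auto
    ultimately show ?thesis
      using card_even_acyclic_with_sinks[of ?V S] that by simp
  qed
  have "int (num_acyclic_even_out n) = (\<Sum>S | S \<subseteq> ?V \<and> S \<noteq> {}.
      (- 1) ^ (card S + 1) * int (card {E \<in> even_acyclic_rels ?V. E `` S = {}}))"
    unfolding num_acyclic_even_out_eq
    using assms by (intro even_acyclic_eq_sum_over_sinks) auto
  also have "\<dots> = (\<Sum>S | S \<subseteq> ?V \<and> S \<noteq> {}. ?g (card S))"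
    using sink_count by (intro sum.cong) auto
  also have "\<dots> = (\<Sum>k = 1..n. int (n choose k) * ?g k)"
    using sum_nonempty_subsets_by_card[of ?V ?g] by simp
  finally show ?thesis by (simp add: mult_ac)
qed

end
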